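(* For every integer $k\geq 3$ there exists a $k$-regular asymmetric Hamiltonian graph.
   Context: Graphs are finite, undirected, without loops or multiple edges. A graph is asymmetric if its automorphism group (acting on vertices) is trivial. *)

theory Defs
  imports "Graph_Theory.Graph_Theory"
begin

text \<open>
  A finite simple graph is a \<^locale>\<open>pair_graph\<close>: a finite, symmetric, loop-free digraph whose
  arcs are pairs of vertices, each undirected edge being a pair of opposite arcs.
  The out-degree of a vertex is therefore its number of neighbours.
\<close>

definition regular :: "nat \<Rightarrow> ('a, 'b) pre_digraph \<Rightarrow> bool" where
  "regular k G \<longleftrightarrow> (\<forall>v \<in> verts G. out_degree G v = k)"

definition automorphism :: "('a, 'b) pre_digraph \<Rightarrow> ('a, 'b, 'a, 'b) digraph_isomorphism \<Rightarrow> bool" where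
  "automorphism G h \<longleftrightarrow> pre_digraph.digraph_isomorphism G h \<and> app_iso h G = G"

text \<open>
  The maps of an automorphism are arbitrary outside the graph, so triviality is only asked
  for on the vertices of the graph.
\<close>

definition asymmetric :: "('a, 'b) pre_digraph \<Rightarrow> bool" where
  "asymmetric G \<longleftrightarrow> (\<forall>h. automorphism G h \<longrightarrow> (\<forall>v \<in> verts G. iso_verts h v = v))"

text \<open>
  In the library's sense of cycle, traversing an edge forth and back is a cycle of length 2.
  The length bound excludes it, as usual for undirected graphs.
\<close>

definition hamiltonian_cycle :: "('a, 'b) pre_digraph \<Rightarrow> 'b awalk \<Rightarrow> bool" where
  "hamiltonian_cycle G p \<longleftrightarrow>
     pre_digraph.cycle G p \<and> 3 \<le> length p \<and> tail G ` set p = verts G"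

definition hamiltonian :: "('a, 'b) pre_digraph \<Rightarrow> bool" where
  "hamiltonian G \<longleftrightarrow> (\<exists>p. hamiltonian_cycle G p)"

lemma (in pair_wf_digraph) asymmetric_iff:
  "asymmetric (with_proj G) \<longleftrightarrow>
     (\<forall>f. bij_betw f (pverts G) (pverts G) \<and>
          (\<forall>u \<in> pverts G. \<forall>v \<in> pverts G. (f u, f v) \<in> parcs G \<longleftrightarrow> (u, v) \<in> parcs G)
        \<longrightarrow> (\<forall>v \<in> pverts G. f v = v))" (is "?L \<longleftrightarrow> (\<forall>f. ?A f \<longrightarrow> ?T f)")
proof
  assume L: ?L
  show "\<forall>f. ?A f \<longrightarrow> ?T f"
  proof (intro allI impI)
    fix f assume A: "?A f"
    define h where "h = \<lparr>iso_verts = f, iso_arcs = map_prod f f, iso_head = snd, iso_tail = fst\<rparr>"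
    have inj: "inj_on f (pverts G)" and surj: "f ` pverts G = pverts G"
      using A by (auto simp: bij_betw_def)
    have "inj_on (map_prod f f) (parcs G)"
      using map_prod_inj_on[OF inj inj] by (rule inj_on_subset) (auto dest: wellformed')
    then have "digraph_isomorphism h"
      using inj wf_digraph by (auto simp: digraph_isomorphism_def h_def)
    moreover have "map_prod f f ` parcs G = parcs G"
    proof
      show "map_prod f f ` parcs G \<subseteq> parcs G"
        using A by (auto dest: wellformed')
      show "parcs G \<subseteq> map_prod f f ` parcs G"
      proof
        fix e assume e: "e \<in> parcs G"
        obtain x y where xy: "e = (x, y)" by fastforce
        with e surj obtain u v where "u \<in> pverts G" "v \<in> pverts G" "f u = x" "f v = y"
          by (metis imageE wellformed')
        with A e xy show "e \<in> map_prod f f ` parcs G"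
          by (metis image_eqI map_prod_simp)
      qed
    qed
    ultimately have "automorphism (with_proj G) h"
      using surj by (simp add: automorphism_def app_iso_def h_def with_proj_def)
    with L show "?T f" by (auto simp: asymmetric_def h_def)
  qed
next
  assume R: "\<forall>f. ?A f \<longrightarrow> ?T f"
  show ?L
    unfolding asymmetric_def
  proof (intro allI impI)
    fix h assume h: "automorphism (with_proj G) h"
    then have iso: "digraph_isomorphism h" and app: "app_iso h (with_proj G) = with_proj G"
      by (auto simp: automorphism_def)
    have V: "iso_verts h ` pverts G = pverts G" and E: "iso_arcs h ` parcs G = parcs G"
      and T: "iso_tail h = fst" and H: "iso_head h = snd"
      using app by (auto simp: app_iso_def with_proj_def)
    have inj: "inj_on (iso_verts h) (pverts G)"
      using iso by (auto simp: digraph_isomorphism_def)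
    have arcs: "iso_arcs h e = (iso_verts h (fst e), iso_verts h (snd e))" if "e \<in> parcs G" for e
      using iso that T H by (auto simp: digraph_isomorphism_def prod_eq_iff)
    have "(iso_verts h u, iso_verts h v) \<in> parcs G \<longleftrightarrow> (u, v) \<in> parcs G"
      if uv: "u \<in> pverts G" "v \<in> pverts G" for u v
    proof
      assume "(u, v) \<in> parcs G"
      then show "(iso_verts h u, iso_verts h v) \<in> parcs G"
        using arcs E by force
    next
      assume "(iso_verts h u, iso_verts h v) \<in> parcs G"
      then obtain e where e: "e \<in> parcs G" "(iso_verts h u, iso_verts h v) = iso_arcs h e"
        using E by blast
      then have "iso_verts h u = iso_verts h (fst e)" "iso_verts h v = iso_verts h (snd e)"
        using arcs by auto
      then have "u = fst e" "v = snd e"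
        using inj_onD[OF inj] uv arc_fst_in_verts[OF e(1)] arc_snd_in_verts[OF e(1)] by blast+
      with e(1) show "(u, v) \<in> parcs G" by simp
    qed
    then show "\<forall>v \<in> verts (with_proj G). iso_verts h v = v"
      using R inj V by (simp add: bij_betw_def)
  qed
qed

end

theory Submission
  imports Defs
begin

text \<open>
  The complement of a 4-regular asymmetric graph on \<open>n\<close> vertices is asymmetric and \<open>(n - 5)\<close>-regular,
  and it has many Hamiltonian cycles when the 4-regular graph has few long edges. So it suffices to
  perturb the square of a cycle on \<open>n \<ge> 10\<close> vertices locally: the perturbation pins down a few
  vertices, and then all others are fixed one after the other, because the square of a cycle is
  determined by a few consecutive vertices. This settles \<open>k \<ge> 5\<close>; the perturbed graph for \<open>n = 10\<close>
  is itself Hamiltonian and settles \<open>k = 4\<close>. For \<open>k = 3\<close> take a suitable cubic graph on 12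
  vertices.
\<close>

section \<open>Graphs on an initial segment of the naturals\<close>

text \<open>Arcs are cut down to \<open>{..<n}\<close> here, so relations such as
  \<open>quartic\<close> can be written as formulas without vertex bounds.\<close>

definition graph_on :: "nat \<Rightarrow> (nat \<Rightarrow> nat \<Rightarrow> bool) \<Rightarrow> nat pair_pre_digraph" where
  "graph_on n E = \<lparr>pverts = {..<n}, parcs = {(u, v). u < n \<and> v < n \<and> E u v}\<rparr>"

lemma pverts_graph_on [simp]: "pverts (graph_on n E) = {..<n}"
  and parcs_graph_on [simp]: "parcs (graph_on n E) = {(u, v). u < n \<and> v < n \<and> E u v}"
  by (simp_all add: graph_on_def)

lemma pair_graph_graph_on:
  assumes "symp E" "irreflp E"
  shows "pair_graph (graph_on n E)"
proof unfold_locales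
  show "finite (parcs (graph_on n E))"
    by (rule finite_subset[of _ "{..<n} \<times> {..<n}"]) auto
  show "symmetric (with_proj (graph_on n E))"
    using assms(1) by (auto simp: symmetric_def sym_def arcs_ends_def arc_to_ends_def symp_def)
qed (use assms(2) in \<open>auto simp: irreflp_def\<close>)

lemma regular_graph_on:
  assumes "\<And>u. u < n \<Longrightarrow> card {v. v < n \<and> E u v} = k"
  shows "regular k (with_proj (graph_on n E))"
proof -
  have "out_degree (with_proj (graph_on n E)) u = k" if "u < n" for u
  proof -
    have "out_arcs (with_proj (graph_on n E)) u = Pair u ` {v. v < n \<and> E u v}"
      using that by (auto simp: out_arcs_def)
    then show ?thesis
      using assms[OF that] by (simp add: out_degree_def card_image inj_on_def)
  qed
  then show ?thesis by (simp add: regular_def)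
qed

section \<open>Automorphisms as adjacency-preserving permutations\<close>

definition automorphism_on :: "nat \<Rightarrow> (nat \<Rightarrow> nat \<Rightarrow> bool) \<Rightarrow> (nat \<Rightarrow> nat) \<Rightarrow> bool" where
  "automorphism_on n E f \<longleftrightarrow>
     bij_betw f {..<n} {..<n} \<and> (\<forall>u<n. \<forall>v<n. E (f u) (f v) \<longleftrightarrow> E u v)"

definition rigid :: "nat \<Rightarrow> (nat \<Rightarrow> nat \<Rightarrow> bool) \<Rightarrow> bool" where
  "rigid n E \<longleftrightarrow> (\<forall>f. automorphism_on n E f \<longrightarrow> (\<forall>v<n. f v = v))"

lemma automorphism_onD:
  assumes "automorphism_on n E f"
  shows "u < n \<Longrightarrow> f u < n"
    and "\<lbrakk>u < n; v < n\<rbrakk> \<Longrightarrow> E (f u) (f v) \<longleftrightarrow> E u v"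
    and "\<lbrakk>u < n; v < n\<rbrakk> \<Longrightarrow> f u = f v \<longleftrightarrow> u = v"
    and "w < n \<Longrightarrow> \<exists>u<n. f u = w"
proof -
  have b: "inj_on f {..<n}" "f ` {..<n} = {..<n}"
    using assms by (auto simp: automorphism_on_def bij_betw_def)
  show "u < n \<Longrightarrow> f u < n" using b(2) by blast
  show "\<lbrakk>u < n; v < n\<rbrakk> \<Longrightarrow> E (f u) (f v) \<longleftrightarrow> E u v"
    using assms by (simp add: automorphism_on_def)
  show "\<lbrakk>u < n; v < n\<rbrakk> \<Longrightarrow> f u = f v \<longleftrightarrow> u = v"
    using b(1) by (auto simp: inj_on_eq_iff)
  show "w < n \<Longrightarrow> \<exists>u<n. f u = w" using b(2) by (metis imageE lessThan_iff)
qed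

text \<open>By \<open>asymmetric_iff\<close>, only vertex permutations matter. The bounds that
  \<open>parcs\<close> adds to adjacency hold automatically, since a permutation of
  \<open>{..<n}\<close> stays below \<open>n\<close>.\<close>

lemma asymmetric_graph_on:
  assumes "symp E" "irreflp E" "rigid n E"
  shows "asymmetric (with_proj (graph_on n E))"
proof -
  interpret pair_graph "graph_on n E"
    using assms(1,2) by (rule pair_graph_graph_on)
  have "automorphism_on n E f"
    if "bij_betw f {..<n} {..<n}"
      "\<forall>u<n. \<forall>v<n. (f u < n \<and> f v < n \<and> E (f u) (f v)) \<longleftrightarrow> E u v" for f
  proof -
    have "f u < n" if "u < n" for u
      using that \<open>bij_betw f {..<n} {..<n}\<close> by (auto simp: bij_betw_def)
    with that show ?thesis by (simp add: automorphism_on_def)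
  qed
  then show ?thesis
    using assms(3) by (simp add: asymmetric_iff rigid_def Ball_def)
qed

lemma hamiltonian_graph_on:
  assumes "symp E" "irreflp E" "3 \<le> n"
    and w: "inj_on w {..<n}" "w ` {..<n} \<subseteq> {..<n}" "w n = w 0"
    and adj: "\<And>i. i < n \<Longrightarrow> E (w i) (w (Suc i))"
  shows "hamiltonian (with_proj (graph_on n E))"
proof -
  let ?G = "graph_on n E"
  interpret pair_graph ?G
    using assms(1,2) by (rule pair_graph_graph_on)
  define p where "p = map (\<lambda>i. (w i, w (Suc i))) [0..<n]"
  have surj: "w ` {..<n} = {..<n}"
    using w by (simp add: endo_inj_surj)
  have wn: "w i < n" if "i \<le> n" for i
    using that w \<open>3 \<le> n\<close> by (cases "i = n") (auto simp: image_subset_iff)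
  \<comment> \<open>The start \<open>a\<close> is arbitrary because \<open>pcas\<close> peels off
    the first arc, so the induction must move the start.\<close>
  have "pcas (w a) (map (\<lambda>i. (w i, w (Suc i))) [a..<a + m]) (w (a + m))" for a m
  proof (induction m arbitrary: a)
    case (Suc m)
    then show ?case using Suc.IH[of "Suc a"] by (simp add: upt_conv_Cons del: upt_Suc)
  qed simp
  from this[of 0 n] have cas: "pcas (w 0) p (w 0)"
    using w(3) by (simp add: p_def)
  have "set p \<subseteq> parcs ?G"
    using wn adj by (auto simp: p_def)
  with cas have awalk: "awalk (w 0) p (w 0)"
    using wn[of 0] by (simp add: awalk_def)
  have "p \<noteq> []" using \<open>3 \<le> n\<close> by (simp add: p_def)
  \<comment> \<open>\<open>cycle\<close> asks for distinctness after dropping the first vertex of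
    the closed walk; this leaves \<open>w 1, ..., w n\<close>, and \<open>w n = w 0\<close> reduces
    it to injectivity on \<open>{..<n}\<close>.\<close>
  then have "tl (pawalk_verts (w 0) p) = map (w \<circ> Suc) [0..<n]"
    using awalk_verts_conv'[OF cas] by (simp add: p_def)
  also have "\<dots> = map w [Suc 0..<n] @ [w 0]"
  proof -
    have "map (w \<circ> Suc) [0..<n] = map w (map Suc [0..<n])" by simp
    also have "\<dots> = map w ([Suc 0..<n] @ [n])"
      using \<open>3 \<le> n\<close> by (simp only: map_Suc_upt) simp
    finally show ?thesis using w(3) by simp
  qed
  also have "distinct \<dots>"
    using inj_on_subset[OF w(1), of "{Suc 0..<n}"] inj_onD[OF w(1), of 0] \<open>3 \<le> n\<close>
    by (fastforce simp: distinct_map)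
  finally have "cycle p"
    using awalk \<open>p \<noteq> []\<close> by (auto simp: cycle_def)
  moreover have "fst ` set p = {..<n}"
    using surj by (simp add: p_def image_image lessThan_atLeast0)
  ultimately show ?thesis
    using \<open>3 \<le> n\<close> unfolding hamiltonian_def hamiltonian_cycle_def
    by (intro exI[of _ p]) (simp add: p_def)
qed

section \<open>Complements, and vertices forced to be fixed\<close>

definition complement :: "(nat \<Rightarrow> nat \<Rightarrow> bool) \<Rightarrow> nat \<Rightarrow> nat \<Rightarrow> bool" where
  "complement E u v \<longleftrightarrow> u \<noteq> v \<and> \<not> E u v"

lemma symp_complement: "symp E \<Longrightarrow> symp (complement E)"
  by (auto simp: symp_def complement_def)

lemma irreflp_complement: "irreflp (complement E)"
  by (simp add: irreflp_def complement_def)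

lemma rigid_complement:
  assumes "irreflp E" "rigid n E"
  shows "rigid n (complement E)"
  unfolding rigid_def
proof (intro allI impI)
  fix f v assume f: "automorphism_on n (complement E) f" and "v < n"
  have "E (f x) (f y) \<longleftrightarrow> E x y" if "x < n" "y < n" for x y
    using automorphism_onD(2,3)[OF f that] assms(1) by (auto simp: complement_def irreflp_def)
  with f have "automorphism_on n E f" by (simp add: automorphism_on_def)
  with assms(2) \<open>v < n\<close> show "f v = v" by (simp add: rigid_def)
qed

lemma card_complement:
  assumes "irreflp E" "u < n"
  shows "card {v. v < n \<and> complement E u v} = n - 1 - card {v. v < n \<and> E u v}"
proof -
  have "{v. v < n \<and> complement E u v} = {..<n} - {u} - {v. v < n \<and> E u v}"
    by (auto simp: complement_def)
  moreover have "card ({..<n} - {u} - {v. v < n \<and> E u v}) =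
      card ({..<n} - {u}) - card {v. v < n \<and> E u v}"
    using assms by (intro card_Diff_subset) (auto simp: irreflp_def)
  ultimately show ?thesis using assms(2) by simp
qed

text \<open>An automorphism fixing \<open>u\<close> permutes the neighbours of \<open>u\<close>. If
  \<open>f v\<close> were a neighbour other than \<open>v\<close>, it would be fixed, and
  injectivity would give \<open>f v = v\<close>. This propagates fixedness through both
  graphs.\<close>

lemma fixed_last_neighbour:
  assumes f: "automorphism_on n E f"
    and "u < n" "v < n" "f u = u" "E u v"
    and last: "\<And>w. \<lbrakk>w < n; E u w; w \<noteq> v\<rbrakk> \<Longrightarrow> f w = w"
  shows "f v = v"
proof (rule ccontr)
  assume "f v \<noteq> v"
  moreover have "f v < n" "E u (f v)"
    using automorphism_onD(1)[OF f, of v] automorphism_onD(2)[OF f, of u v] assms by auto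
  ultimately have "f (f v) = f v" by (intro last)
  with \<open>f v \<noteq> v\<close> show False
    using automorphism_onD(1,3)[OF f] \<open>v < n\<close> by metis
qed

section \<open>Perturbed squares of cycles\<close>

text \<open>
  The square of the cycle on \<open>n\<close> vertices, in which the edges \<open>(n - 1) 0\<close>, \<open>0 2\<close> and \<open>3 4\<close> are
  replaced by \<open>(n - 1) 2\<close>, \<open>0 3\<close> and \<open>0 4\<close>. Removing \<open>(n - 1) 0\<close> is what allows the regular pattern
  \<open>0, h, 1, h + 1, \<dots>, n - 1\<close> to close up to a Hamiltonian cycle of the complement.
\<close>
definition quartic_less :: "nat \<Rightarrow> nat \<Rightarrow> nat \<Rightarrow> bool" where
  "quartic_less n u v \<longleftrightarrow> v = u + 1 \<and> u \<noteq> 3 \<or> v = u + 2 \<and> u \<noteq> 0 \<or>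
     u = 0 \<and> (v = 3 \<or> v = 4 \<or> v + 2 = n) \<or> v + 1 = n \<and> (u = 1 \<or> u = 2)"

definition quartic :: "nat \<Rightarrow> nat \<Rightarrow> nat \<Rightarrow> bool" where
  "quartic n u v \<longleftrightarrow> u < v \<and> quartic_less n u v \<or> v < u \<and> quartic_less n v u"

lemma symp_quartic: "symp (quartic n)"
  by (auto simp: symp_def quartic_def)

lemma irreflp_quartic: "irreflp (quartic n)"
  by (simp add: irreflp_def quartic_def)

lemma quartic_neighbours:
  assumes "10 \<le> n" "v < n"
  shows quartic_0: "quartic n 0 v \<longleftrightarrow> v = 1 \<or> v = 3 \<or> v = 4 \<or> v + 2 = n"
    and quartic_1: "quartic n 1 v \<longleftrightarrow> v = 0 \<or> v = 2 \<or> v = 3 \<or> v + 1 = n"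
    and quartic_2: "quartic n 2 v \<longleftrightarrow> v = 1 \<or> v = 3 \<or> v = 4 \<or> v + 1 = n"
    and quartic_3: "quartic n 3 v \<longleftrightarrow> v = 0 \<or> v = 1 \<or> v = 2 \<or> v = 5"
    and quartic_4: "quartic n 4 v \<longleftrightarrow> v = 0 \<or> v = 2 \<or> v = 5 \<or> v = 6"
    and quartic_5: "quartic n 5 v \<longleftrightarrow> v = 3 \<or> v = 4 \<or> v = 6 \<or> v = 7"
    and quartic_middle: "\<lbrakk>6 \<le> u; u + 2 < n\<rbrakk> \<Longrightarrow>
      quartic n u v \<longleftrightarrow> v + 2 = u \<or> v + 1 = u \<or> v = u + 1 \<or> v = u + 2"
    and quartic_penultimate: "u + 2 = n \<Longrightarrow>
      quartic n u v \<longleftrightarrow> v = 0 \<or> v + 4 = n \<or> v + 3 = n \<or> v + 1 = n"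
    and quartic_last: "u + 1 = n \<Longrightarrow>
      quartic n u v \<longleftrightarrow> v = 1 \<or> v = 2 \<or> v + 3 = n \<or> v + 2 = n"
  using assms unfolding quartic_def quartic_less_def by presburger+

lemma card_quartic:
  assumes n: "10 \<le> n" and u: "u < n"
  shows "card {v. v < n \<and> quartic n u v} = 4"
proof -
  have *: ?thesis if "distinct [a, b, c, d]" "{a, b, c, d} \<subseteq> {..<n}"
    "\<And>v. v < n \<Longrightarrow> quartic n u v \<longleftrightarrow> v = a \<or> v = b \<or> v = c \<or> v = d" for a b c d
  proof -
    have "{v. v < n \<and> quartic n u v} = {a, b, c, d}" using that(2,3) by auto
    with that(1) show ?thesis by simp
  qed
  consider "u = 0" | "u = 1" | "u = 2" | "u = 3" | "u = 4" | "u = 5" | "6 \<le> u" "u + 2 < n"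
    | "u + 2 = n" | "u + 1 = n"
    using u by linarith
  then show ?thesis
  proof cases
    case 1
    then show ?thesis using n quartic_0[OF n] by (intro *[of 1 3 4 "n - 2"]) auto
  next
    case 2
    then show ?thesis using n quartic_1[OF n] by (intro *[of 0 2 3 "n - 1"]) auto
  next
    case 3
    then show ?thesis using n quartic_2[OF n] by (intro *[of 1 3 4 "n - 1"]) auto
  next
    case 4
    then show ?thesis using n quartic_3[OF n] by (intro *[of 0 1 2 5]) auto
  next
    case 5
    then show ?thesis using n quartic_4[OF n] by (intro *[of 0 2 5 6]) auto
  next
    case 6
    then show ?thesis using n quartic_5[OF n] by (intro *[of 3 4 6 7]) auto
  next
    case 7
    then show ?thesis
      using quartic_middle[OF n _ 7] by (intro *[of "u - 2" "u - 1" "u + 1" "u + 2"]) auto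
  next
    case 8
    then show ?thesis
      using n quartic_penultimate[OF n _ 8] by (intro *[of 0 "n - 4" "n - 3" "n - 1"]) auto
  next
    case 9
    show ?thesis
    proof (rule *[of 1 2 "u - 2" "u - 1"])
      show "quartic n u v \<longleftrightarrow> v = 1 \<or> v = 2 \<or> v = u - 2 \<or> v = u - 1" if "v < n" for v
        using n 9 quartic_last[OF n that 9] by presburger
    qed (use n 9 in auto)
  qed
qed

section \<open>Edges in no triangle, an automorphism invariant\<close>

definition bare :: "nat \<Rightarrow> (nat \<Rightarrow> nat \<Rightarrow> bool) \<Rightarrow> nat \<Rightarrow> nat \<Rightarrow> bool" where
  "bare n E u v \<longleftrightarrow> E u v \<and> (\<forall>w<n. \<not> (E u w \<and> E v w))"

text \<open>A common neighbour of \<open>f u\<close> and \<open>f v\<close> is itself an image, by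
  surjectivity, so it pulls back to one of \<open>u\<close> and \<open>v\<close>.\<close>

lemma bare_automorphism:
  assumes f: "automorphism_on n E f" and "u < n" "v < n" "bare n E u v"
  shows "bare n E (f u) (f v)"
  using assms(2-4) automorphism_onD(2,4)[OF f] unfolding bare_def by metis

lemma bare_commute:
  assumes "symp E"
  shows "bare n E u v \<longleftrightarrow> bare n E v u"
  using assms by (auto simp: bare_def symp_def)

text \<open>Deleting 3 4 and \<open>n - 1\<close>, 0 removes the middle vertex between 2 and 4, 3
  and 5, and \<open>n - 2\<close> and 0; the new edge 0 4 has no common neighbour either. For every
  other edge a common neighbour is exhibited.\<close>

lemma bare_quartic_less:
  assumes n: "10 \<le> n" and "u < v" "v < n"
  shows "bare n (quartic n) u v \<longleftrightarrow>
    u = 0 \<and> v = 4 \<or> u = 0 \<and> v + 2 = n \<or> u = 2 \<and> v = 4 \<or> u = 3 \<and> v = 5"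
proof
  assume bare: "bare n (quartic n) u v"
  then have E: "quartic_less n u v"
    using assms by (simp add: bare_def quartic_def)
  have no: "\<not> (quartic n u w \<and> quartic n v w)" if "w < n" for w
    using bare that by (simp add: bare_def)
  from E consider "v = u + 1" "u \<noteq> 3" | "v = u + 2" "u \<noteq> 0" | "u = 0" "v = 3"
    | "u = 0" "v = 4" | "u = 0" "v + 2 = n" | "v + 1 = n" "u = 1 \<or> u = 2"
    by (auto simp: quartic_less_def)
  then show "u = 0 \<and> v = 4 \<or> u = 0 \<and> v + 2 = n \<or> u = 2 \<and> v = 4 \<or> u = 3 \<and> v = 5"
  proof cases
    case 1
    consider "u < 2" | "u = 2" | "4 \<le> u" "u + 2 < n" | "4 \<le> u" "u + 2 = n"
      using 1 assms by linarith
    then show ?thesis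
    proof cases
      case 1
      with no[of 3] \<open>v = u + 1\<close> n show ?thesis unfolding quartic_def quartic_less_def by presburger
    next
      case 2
      with no[of 1] \<open>v = u + 1\<close> n show ?thesis unfolding quartic_def quartic_less_def by presburger
    next
      case 3
      with no[of "u + 2"] \<open>v = u + 1\<close> show ?thesis
        unfolding quartic_def quartic_less_def by presburger
    next
      case 4
      with no[of "u - 1"] \<open>v = u + 1\<close> n show ?thesis
        unfolding quartic_def quartic_less_def by presburger
    qed
  next
    case 2
    \<comment> \<open>The middle vertex \<open>u + 1\<close> works unless \<open>u\<close> is 2 or
      3, where the missing edge 3 4 would be used.\<close>
    with no[of "u + 1"] \<open>v < n\<close> show ?thesis unfolding quartic_def quartic_less_def by presburger
  next
    case 3
    with no[of 1] n show ?thesis unfolding quartic_def quartic_less_def by presburger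
  next
    case 6
    then show ?thesis
    proof (elim disjE)
      assume "u = 1"
      with 6 no[of 2] n show ?thesis unfolding quartic_def quartic_less_def by presburger
    next
      assume "u = 2"
      with 6 no[of 1] n show ?thesis unfolding quartic_def quartic_less_def by presburger
    qed
  qed auto
next
  assume "u = 0 \<and> v = 4 \<or> u = 0 \<and> v + 2 = n \<or> u = 2 \<and> v = 4 \<or> u = 3 \<and> v = 5"
  then show "bare n (quartic n) u v"
    using n quartic_neighbours[OF n] \<open>v < n\<close> unfolding bare_def
    by (elim disjE conjE) auto
qed

text \<open>Both orientations are listed because an automorphism may reverse the order of the
  endpoints.\<close>

lemma bare_quartic:
  assumes "10 \<le> n" "u < n" "v < n" "bare n (quartic n) u v"
  shows "(u, v) \<in> {(0, 4), (4, 0), (0, n - 2), (n - 2, 0), (3, 5), (5, 3), (2, 4), (4, 2)}"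
proof -
  have "u \<noteq> v" using assms(4) by (auto simp: bare_def quartic_def)
  then show ?thesis
    using assms bare_quartic_less[of n u v] bare_quartic_less[of n v u]
      bare_commute[OF symp_quartic, of n n u v]
    by (cases u v rule: linorder_cases) auto
qed

text \<open>
  The edges in no triangle form the path \<open>n - 2, 0, 4, 2\<close> and the edge \<open>3 5\<close>. The edge \<open>2 3\<close> joins
  an end of the path to the other component, while \<open>n - 2\<close> is adjacent to neither \<open>3\<close> nor \<open>5\<close>; so
  every automorphism fixes these six vertices. From there on, vertices are fixed as last
  neighbours of fixed vertices.
\<close>
lemma rigid_quartic:
  assumes n: "10 \<le> n"
  shows "rigid n (quartic n)"
  unfolding rigid_def
proof (intro allI impI)
  fix f v assume f: "automorphism_on n (quartic n) f" and "v < n"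
  note last = fixed_last_neighbour[OF f]
  have lt: "f u < n" if "u < n" for u using automorphism_onD(1)[OF f that] .
  define m where "m = n - 2"
  have m: "m \<notin> {0, 1, 2, 3, 4, 5}" "m < n" "m + 2 = n"
    using n by (auto simp: m_def)
  let ?P = "{(0, 4), (4, 0), (0, m), (m, 0), (3, 5), (5, 3), (2, 4), (4, 2)}"
  have bare: "(f x, f y) \<in> ?P"
    if "x < y" "y < n" "x = 0 \<and> y = 4 \<or> x = 0 \<and> y + 2 = n \<or> x = 2 \<and> y = 4 \<or> x = 3 \<and> y = 5" for x y
    using that bare_quartic[OF n] bare_automorphism[OF f] bare_quartic_less[OF n] lt
    by (simp add: m_def)
  have P: "(f 0, f 4) \<in> ?P" "(f 0, f m) \<in> ?P" "(f 2, f 4) \<in> ?P" "(f 3, f 5) \<in> ?P"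
    using n m by (intro bare; simp)+
  have neq: "f 0 \<noteq> f 2" "f m \<noteq> f 4" "f 3 \<noteq> f 4"
    using automorphism_onD(3)[OF f] n m by auto
  \<comment> \<open>Here \<open>d, a, b, c\<close> stand for the images of the path
    \<open>m, 0, 4, 2\<close>. Since \<open>a\<close> and \<open>b\<close> each lie on two of these
    edges, they are 0 and 4 in some order: the path is fixed or reversed. Of the reversal, only what
    refutes it later is kept.\<close>
  have "a = 0 \<and> b = 4 \<and> c = 2 \<and> d = m \<or> b = 0 \<and> c = m"
    if ab: "(a, b) \<in> ?P" and ad: "(a, d) \<in> ?P" and cb: "(c, b) \<in> ?P" and "a \<noteq> c" "d \<noteq> b"
    for a b c d
  proof -
    have "(a = 0 \<or> a = 4) \<or> a = m \<and> b = 0 \<and> d = 0 \<or> a = 3 \<and> b = 5 \<and> d = 5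
        \<or> a = 5 \<and> b = 3 \<and> d = 3 \<or> a = 2 \<and> b = 4 \<and> d = 4"
      using ab ad m(1) by (elim insertE emptyE) simp_all
    with \<open>d \<noteq> b\<close> consider "a = 0" | "a = 4" by blast
    then show ?thesis
    proof cases
      case 1
      then have "b = 4 \<or> b = m" "d = 4 \<or> d = m" using ab ad m(1) by simp_all
      moreover have "b \<noteq> m" using cb m(1) \<open>a \<noteq> c\<close> 1 by auto
      moreover have "c = 2" if "b = 4" using cb m(1) \<open>a \<noteq> c\<close> 1 that by simp
      ultimately show ?thesis using 1 \<open>d \<noteq> b\<close> by blast
    next
      case 2
      then have "b = 0 \<or> b = 2" using ab m(1) by simp
      moreover have "b \<noteq> 2" using cb m(1) \<open>a \<noteq> c\<close> 2 by auto
      moreover have "c = m" if "b = 0" using cb m(1) \<open>a \<noteq> c\<close> 2 that by simp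
      ultimately show ?thesis by blast
    qed
  qed
  from this[OF P(1-3) neq(1,2)]
  have outer: "f 0 = 0 \<and> f 4 = 4 \<and> f 2 = 2 \<and> f m = m \<or> f 4 = 0 \<and> f 2 = m" .
  have f3: "f 3 \<in> {0, 2, 3, 4, 5, m}"
    using P(4) by auto
  have adj: "quartic n (f 2) (f 3)"
    using automorphism_onD(2)[OF f, of 2 3] quartic_2[OF n, of 3] n by simp
  \<comment> \<open>In the reversed case \<open>f 3\<close> is adjacent to \<open>m\<close> and lies
    on a triangle-free edge, which leaves only 0; but 0 is already \<open>f 4\<close>.\<close>
  have "f 2 \<noteq> m"
  proof
    assume "f 2 = m"
    then have "f 3 = 0"
      using f3 adj quartic_penultimate[OF n lt m(3), of 3] n m by auto
    with \<open>f 2 = m\<close> outer neq(3) m(1) show False by auto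
  qed
  with outer have fixed: "f 0 = 0" "f 2 = 2" "f 4 = 4" "f m = m"
    by auto
  then have "f 3 = 3"
    using f3 adj neq(3) quartic_2[OF n lt, of 3] n m by auto
  with P(4) m(1) have "f 5 = 5" by auto
  note fixed = fixed \<open>f 3 = 3\<close> \<open>f 5 = 5\<close>
  have f1: "f 1 = 1"
    using n fixed quartic_0[OF n] by (intro last[of 0 1]) (auto simp: m_def)
  have f6: "f 6 = 6"
    using n fixed quartic_4[OF n] by (intro last[of 4 6]) auto
  show "f v = v"
    using \<open>v < n\<close>
  proof (induction v rule: less_induct)
    case (less v)
    consider "v < 6" | "v = 6" | "v = 7" | "8 \<le> v" by linarith
    then show ?case
    proof cases
      case 1
      then have "v \<in> {0, 1, 2, 3, 4, 5}" by auto
      with fixed f1 show ?thesis by auto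
    next
      case 3
      then show ?thesis
        using n fixed f6 quartic_5[OF n] by (intro last[of 5 v]) auto
    next
      case 4
      \<comment> \<open>From 8 on, \<open>v - 2\<close> is a middle vertex, and \<open>v\<close> is
        its largest neighbour; the other three are covered by the induction hypothesis.\<close>
      then have "quartic n (v - 2) w \<longleftrightarrow> w + 4 = v \<or> w + 3 = v \<or> w + 1 = v \<or> w = v" if "w < n" for w
        using quartic_middle[OF n that, of "v - 2"] less.prems by auto
      with 4 less show ?thesis
        by (intro last[of "v - 2" v]) auto
    qed (use f6 in simp)
  qed
qed

section \<open>Hamiltonian cycles in the quartic graph and in its complement\<close>

lemma hamiltonian_quartic_10: "hamiltonian (with_proj (graph_on 10 (quartic 10)))"
proof (rule hamiltonian_graph_on)
  let ?w = "\<lambda>i. [0, 3, 1, 2, 9, 8, 7, 5, 6, 4, 0 :: nat] ! i"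
  have 10: "{..<10} = {0, 1, 2, 3, 4, 5, 6, 7, 8, 9 :: nat}" by auto
  show "inj_on ?w {..<10}" unfolding 10 by simp
  show "?w ` {..<10} \<subseteq> {..<10}" unfolding 10 by simp
  have "\<forall>i\<in>{..<10}. quartic 10 (?w i) (?w (Suc i))"
    unfolding 10 by (simp add: quartic_def quartic_less_def)
  then show "quartic 10 (?w i) (?w (Suc i))" if "i < 10" for i
    using that by blast
qed (simp_all add: symp_quartic irreflp_quartic)

text \<open>The last two hypotheses exclude exactly the edges of \<open>quartic n\<close> between
  numbers at least 4 apart: 0 4, \<open>0, n - 2\<close>, \<open>1, n - 1\<close> and
  \<open>2, n - 1\<close>.\<close>

lemma complement_quartic_far:
  assumes "10 \<le> n" "u + 4 \<le> v" "v < n"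
    "u = 0 \<Longrightarrow> v \<noteq> 4 \<and> v + 2 \<noteq> n" "v + 1 = n \<Longrightarrow> u = 0 \<or> 3 \<le> u"
  shows "complement (quartic n) u v" "complement (quartic n) v u"
  using assms by (auto simp: complement_def quartic_def quartic_less_def)

lemma hamiltonian_complement_quartic:
  assumes n: "10 \<le> n"
  shows "hamiltonian (with_proj (graph_on n (complement (quartic n))))"
proof (rule hamiltonian_graph_on)
  \<comment> \<open>Rounding up gives \<open>h\<close> at least 5, so consecutive vertices of
    \<open>0, h, 1, h + 1, ...\<close> differ by \<open>h\<close> or \<open>h - 1\<close>, hence by
    at least 4.\<close>
  define h where "h = (n + 1) div 2"
  have h: "n = 2 * h \<or> n + 1 = 2 * h"
    unfolding h_def by presburger
  define w where "w i = (if i = n then 0 else if even i then i div 2 else h + i div 2)" for i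
  have w_even: "w (2 * j) = j" if "2 * j < n" for j
    using that by (simp add: w_def)
  have w_odd: "w (2 * j + 1) = h + j" if "2 * j + 1 < n" for j
    using that by (simp add: w_def)
  have parity: "\<exists>j. i = 2 * j \<or> i = 2 * j + 1" for i :: nat
    by presburger
  show "inj_on w {..<n}"
  proof (rule inj_onI)
    fix i i' assume i: "i \<in> {..<n}" and i': "i' \<in> {..<n}" and eq: "w i = w i'"
    obtain j j' where "i = 2 * j \<or> i = 2 * j + 1" "i' = 2 * j' \<or> i' = 2 * j' + 1"
      using parity by metis
    then show "i = i'"
      using i i' eq h w_even w_odd by (elim disjE) simp_all
  qed
  show "w ` {..<n} \<subseteq> {..<n}"
  proof
    fix v assume "v \<in> w ` {..<n}"
    then obtain i where "i < n" "v = w i" by blast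
    moreover obtain j where "i = 2 * j \<or> i = 2 * j + 1" using parity by blast
    ultimately show "v \<in> {..<n}"
      using h w_even w_odd by (elim disjE) simp_all
  qed
  show "complement (quartic n) (w i) (w (Suc i))" if "i < n" for i
  proof -
    obtain j where j: "i = 2 * j \<or> i = 2 * j + 1" using parity by blast
    have w_n: "w n = 0" by (simp add: w_def)
    consider "i + 1 = n" "i = 2 * j" | "i + 1 = n" "i = 2 * j + 1"
      | "i + 1 < n" "i = 2 * j" | "i + 1 < n" "i = 2 * j + 1"
      using \<open>i < n\<close> j by linarith
    then show ?thesis
    proof cases
      \<comment> \<open>Here \<open>n\<close> is odd, so at least 11, and the last vertex
        \<open>j\<close> is at least 5; this avoids the edge 0 4.\<close>
      case 1
      then have "w i = j" "w (Suc i) = 0" using w_even[of j] w_n by simp_all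
      moreover have "complement (quartic n) j 0"
        using 1 n by (intro complement_quartic_far(2)) auto
      ultimately show ?thesis by simp
    next
      \<comment> \<open>Here \<open>n\<close> is even and the last vertex is \<open>n - 1\<close>;
        closing up uses that its edge to 0 was removed.\<close>
      case 2
      then have "w i = h + j" "w (Suc i) = 0" using w_odd[of j] w_n by simp_all
      moreover have "complement (quartic n) (h + j) 0"
        using 2 n h by (intro complement_quartic_far(2)) auto
      ultimately show ?thesis by simp
    next
      case 3
      then have "w i = j" "w (Suc i) = h + j" using w_even[of j] w_odd[of j] by simp_all
      moreover have "complement (quartic n) j (h + j)"
        using 3 n h by (intro complement_quartic_far(1)) auto
      ultimately show ?thesis by simp
    next
      case 4
      then have "w i = h + j" "w (Suc i) = j + 1" using w_odd[of j] w_even[of "j + 1"] by simp_all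
      moreover have "complement (quartic n) (h + j) (j + 1)"
        using 4 n h by (intro complement_quartic_far(2)) auto
      ultimately show ?thesis by simp
    qed
  qed
  show "w n = w 0" by (simp add: w_def)
qed (use n in \<open>simp_all add: symp_quartic symp_complement irreflp_complement\<close>)

section \<open>A cubic graph\<close>

text \<open>The 12-cycle \<open>0, 1, ..., 11\<close> with chords 0 2, 1 4, 3 6, 5 9, 7 11 and 8 10.
  Its triangles are 0 1 2 and 8 9 10.\<close>

definition cubic_list :: "nat list list" where
  "cubic_list = [[1, 2, 11], [0, 2, 4], [0, 1, 3], [2, 4, 6], [1, 3, 5], [4, 6, 9],
     [3, 5, 7], [6, 8, 11], [7, 9, 10], [5, 8, 10], [8, 9, 11], [0, 7, 10]]"

definition cubic :: "nat \<Rightarrow> nat \<Rightarrow> bool" where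
  "cubic u v \<longleftrightarrow> u < 12 \<and> v \<in> set (cubic_list ! u)"

lemma less_12_iff:
  "(u :: nat) < 12 \<longleftrightarrow> u = 0 \<or> u = 1 \<or> u = 2 \<or> u = 3 \<or> u = 4 \<or> u = 5 \<or> u = 6 \<or> u = 7 \<or> u = 8 \<or>
    u = 9 \<or> u = 10 \<or> u = 11"
  by (auto simp: numeral_eq_Suc less_Suc_eq)

lemma all_less_12_iff:
  "(\<forall>u<12. P u) \<longleftrightarrow> P 0 \<and> P 1 \<and> P 2 \<and> P 3 \<and> P 4 \<and> P 5 \<and> P 6 \<and> P 7 \<and> P 8 \<and> P 9 \<and> P 10 \<and> P (11 :: nat)"
  by (auto simp: numeral_eq_Suc All_less_Suc)

text \<open>Vertex 1 appears as \<open>Suc 0\<close> on the left because the simplifier normalises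
  \<open>1\<close> to that form.\<close>

lemma cubic_neighbours:
  "cubic 0 v \<longleftrightarrow> v = 1 \<or> v = 2 \<or> v = 11"
  "cubic (Suc 0) v \<longleftrightarrow> v = 0 \<or> v = 2 \<or> v = 4"
  "cubic 2 v \<longleftrightarrow> v = 0 \<or> v = 1 \<or> v = 3"
  "cubic 3 v \<longleftrightarrow> v = 2 \<or> v = 4 \<or> v = 6"
  "cubic 4 v \<longleftrightarrow> v = 1 \<or> v = 3 \<or> v = 5"
  "cubic 5 v \<longleftrightarrow> v = 4 \<or> v = 6 \<or> v = 9"
  "cubic 6 v \<longleftrightarrow> v = 3 \<or> v = 5 \<or> v = 7"
  "cubic 7 v \<longleftrightarrow> v = 6 \<or> v = 8 \<or> v = 11"
  "cubic 8 v \<longleftrightarrow> v = 7 \<or> v = 9 \<or> v = 10"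
  "cubic 9 v \<longleftrightarrow> v = 5 \<or> v = 8 \<or> v = 10"
  "cubic 10 v \<longleftrightarrow> v = 8 \<or> v = 9 \<or> v = 11"
  "cubic 11 v \<longleftrightarrow> v = 0 \<or> v = 7 \<or> v = 10"
  by (simp_all add: cubic_def cubic_list_def)

lemma cubic_sym:
  assumes "cubic u v"
  shows "v < 12 \<and> cubic v u"
proof -
  have "\<forall>u<12. \<forall>v. cubic u v \<longrightarrow> v < 12 \<and> cubic v u"
    unfolding all_less_12_iff by (auto simp: cubic_neighbours)
  moreover have "u < 12" using assms by (simp add: cubic_def)
  ultimately show ?thesis using assms by blast
qed

lemma symp_cubic: "symp cubic"
  using cubic_sym by (auto simp: symp_def)

lemma irreflp_cubic: "irreflp cubic"
proof -
  have "\<forall>u<12. \<not> cubic u u" unfolding all_less_12_iff by (simp add: cubic_neighbours)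
  then show ?thesis by (auto simp: irreflp_def cubic_def)
qed

lemma card_cubic:
  assumes "u < 12"
  shows "card {v. v < 12 \<and> cubic u v} = 3"
proof -
  have "{v. v < 12 \<and> cubic u v} = set (cubic_list ! u)"
    using cubic_sym[of u] assms unfolding cubic_def by blast
  moreover have "\<forall>u<12. card (set (cubic_list ! u)) = 3"
    unfolding all_less_12_iff by (simp add: cubic_list_def)
  ultimately show ?thesis using assms by simp
qed

lemma hamiltonian_cubic: "hamiltonian (with_proj (graph_on 12 cubic))"
proof (rule hamiltonian_graph_on)
  let ?w = "\<lambda>i :: nat. if i = 12 then 0 else i"
  have "\<forall>i<12. cubic (?w i) (?w (Suc i))"
    unfolding all_less_12_iff by (simp add: cubic_neighbours)
  then show "cubic (?w i) (?w (Suc i))" if "i < 12" for i using that by (elim allE impE)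
qed (auto simp: symp_cubic irreflp_cubic inj_on_def)

text \<open>
  Among the vertices outside the two triangles, only \<open>11\<close> has two neighbours on triangles and only
  \<open>6\<close> has none.
\<close>
lemma rigid_cubic: "rigid 12 cubic"
  unfolding rigid_def
proof (intro allI impI)
  fix f v assume f: "automorphism_on 12 cubic f" and "v < (12 :: nat)"
  note last = fixed_last_neighbour[OF f]
  have lt: "f u < 12" if "u < 12" for u using automorphism_onD(1)[OF f that] .
  have adj: "cubic (f u) (f v) \<longleftrightarrow> cubic u v" if "u < 12" "v < 12" for u v
    using automorphism_onD(2)[OF f that] .
  have onto: "\<exists>u<12. f u = w" if "w < 12" for w
    using automorphism_onD(4)[OF f that] .
  define tri where "tri = (\<lambda>u. \<exists>v w. cubic u v \<and> cubic u w \<and> cubic v w)"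
  have "\<forall>u<12. tri u \<longleftrightarrow> u \<in> {0, 1, 2, 8, 9, 10}"
    unfolding all_less_12_iff tri_def
    by (simp add: cubic_neighbours conj_disj_distribR conj_disj_distribL ex_disj_distrib)
  then have tri: "tri u \<longleftrightarrow> u \<in> {0, 1, 2, 8, 9, 10}" if "u < 12" for u
    using that by blast
  have tri_f: "tri (f u) \<longleftrightarrow> tri u" if "u < 12" for u
  proof
    assume "tri (f u)"
    then obtain v w where vw: "cubic (f u) v" "cubic (f u) w" "cubic v w" by (auto simp: tri_def)
    then obtain v' w' where "v' < 12" "f v' = v" "w' < 12" "f w' = w"
      using onto cubic_sym by metis
    with vw adj that show "tri u" unfolding tri_def by metis
  next
    assume "tri u"
    then show "tri (f u)" unfolding tri_def using adj cubic_sym that by metis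
  qed
  have "f 11 = 11"
  proof -
    have unique: "x = 11" if "x < 12" "\<not> tri x" "cubic x y" "cubic x z" "tri y" "tri z" "y \<noteq> z"
      for x y z
      using that(1) unfolding less_12_iff
      by (elim disjE) (use that(2-) in \<open>auto simp: cubic_neighbours tri\<close>)
    show ?thesis
    proof (rule unique)
      show "cubic (f 11) (f 0)" "cubic (f 11) (f 10)"
        by (simp_all add: adj cubic_neighbours)
      show "\<not> tri (f 11)" "tri (f 0)" "tri (f 10)"
        by (simp_all add: tri_f tri)
      show "f 0 \<noteq> f 10" using automorphism_onD(3)[OF f, of 0 10] by simp
    qed (simp add: lt)
  qed
  moreover have "f 6 = 6"
  proof -
    have "\<not> tri y" if y: "cubic (f 6) y" for y
    proof -
      obtain x where x: "x < 12" "f x = y" using onto cubic_sym[OF y] by blast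
      then have "cubic 6 x" using y adj[of 6 x] by simp
      then have "\<not> tri x" using tri x(1) by (auto simp: cubic_neighbours)
      with x tri_f show ?thesis by blast
    qed
    moreover have "\<not> tri (f 6)" using tri_f[of 6] tri[of 6] by simp
    moreover have "\<forall>x<12. \<not> tri x \<and> (\<forall>y. cubic x y \<longrightarrow> \<not> tri y) \<longrightarrow> x = 6"
      unfolding all_less_12_iff by (auto simp: cubic_neighbours tri)
    moreover have "f 6 < 12" by (simp add: lt)
    ultimately show ?thesis by blast
  qed
  \<comment> \<open>7 is the only common neighbour of 6 and 11.\<close>
  moreover from calculation have "f 7 = 7"
    using adj[of 6 7] adj[of 11 7] by (auto simp: cubic_neighbours)
  moreover from calculation have "f 8 = 8"
    by (intro last[of 7 8]) (auto simp: cubic_neighbours)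
  \<comment> \<open>The common neighbours of 8 and 11 are 7 and 10, and 7 is already taken. From
    here on each vertex is the last neighbour of a fixed one.\<close>
  moreover from calculation have "f 10 = 10"
    using adj[of 8 10] adj[of 11 10] automorphism_onD(3)[OF f, of 7 10]
    by (auto simp: cubic_neighbours)
  moreover from calculation have "f 0 = 0"
    by (intro last[of 11 0]) (auto simp: cubic_neighbours)
  moreover from calculation have "f 9 = 9"
    by (intro last[of 8 9]) (auto simp: cubic_neighbours)
  moreover from calculation have "f 5 = 5"
    by (intro last[of 9 5]) (auto simp: cubic_neighbours)
  moreover from calculation have "f 3 = 3"
    by (intro last[of 6 3]) (auto simp: cubic_neighbours)
  moreover from calculation have "f 4 = 4"
    by (intro last[of 5 4]) (auto simp: cubic_neighbours)
  moreover from calculation have "f 2 = 2"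
    by (intro last[of 3 2]) (auto simp: cubic_neighbours)
  moreover from calculation have "f 1 = 1"
    by (intro last[of 2 1]) (auto simp: cubic_neighbours)
  ultimately show "f v = v"
    using \<open>v < 12\<close> unfolding less_12_iff by (elim disjE) simp_all
qed

theorem mainTheorem5:
  fixes k :: nat
  assumes "k \<ge> 3"
  shows "\<exists>G :: nat pair_pre_digraph.
           pair_graph G \<and> regular k (with_proj G) \<and>
           asymmetric (with_proj G) \<and> hamiltonian (with_proj G)"
proof -
  have *: ?thesis if "symp E" "irreflp E" "\<And>u. u < n \<Longrightarrow> card {v. v < n \<and> E u v} = k" "rigid n E"
    "hamiltonian (with_proj (graph_on n E))" for n E
    using that pair_graph_graph_on regular_graph_on asymmetric_graph_on
    by (intro exI[of _ "graph_on n E"]) simp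
  consider "k = 3" | "k = 4" | "5 \<le> k" using assms by linarith
  then show ?thesis
  proof cases
    case 1
    show ?thesis
      by (rule *[OF symp_cubic irreflp_cubic _ rigid_cubic hamiltonian_cubic]) (simp add: 1 card_cubic)
  next
    case 2
    show ?thesis
      by (rule *[OF symp_quartic irreflp_quartic _ rigid_quartic hamiltonian_quartic_10])
        (simp_all add: 2 card_quartic)
  next
    case 3
    \<comment> \<open>The complement has degree \<open>n - 1 - 4\<close>, which must be
      \<open>k\<close>; \<open>k\<close> at least 5 then gives the bound 10 on
      \<open>n\<close>.\<close>
    define n where "n = k + 5"
    have n: "10 \<le> n" using 3 by (simp add: n_def)
    show ?thesis
    proof (rule *[OF _ irreflp_complement _ rigid_complement hamiltonian_complement_quartic[OF n]])
      show "card {v. v < n \<and> complement (quartic n) u v} = k" if "u < n" for u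
        using card_complement[OF irreflp_quartic that] card_quartic[OF n that] by (simp add: n_def)
    qed (simp_all add: n symp_complement symp_quartic irreflp_quartic rigid_quartic)
  qed
qed

end
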